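(* The analog of the Hahn-Banach extension statement fails for horofunctions: there exist a metric space $(X,d)$ with base point $x_0$, a subset $Y\subseteq X$ containing $x_0$ (with the restricted metric and base point $x_0$), and an element $h\in\overline{Y}^{h}$ such that there is no $H\in\overline{X}^{h}$ with $H|_Y=h$.
   Context: For a metric space $(Z,d)$ with base point $x_0\in Z$ and a point $z\in Z$, define $h_z:Z\to\mathbb{R}$ by $h_z(w)=d(w,z)-d(x_0,z)$. The horofunction bordification $\overline{Z}^{h}$ is the closure of $\{h_z: z\in Z\}$ in the space of functions $Z\to\mathbb{R}$ with the topology of uniform convergence on bounded subsets of $Z$. (The superscript $h$ in $\overline{Z}^{h}$ is only notation and is unrelated to any function named $h$.) The elements of $\overline{Z}^{h}$ not of the form $h_z$, $z\in Z$, are called horofunctions. *)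

theory Defs
  imports "HOL-Analysis.Analysis"
begin

text \<open>
  Real functions on a metric space \<open>m\<close> are represented by the functions that are
  extensional on \<open>mspace m\<close>, so that equality in HOL is equality of functions on \<open>mspace m\<close>.
\<close>

definition real_functions :: "'a metric \<Rightarrow> ('a \<Rightarrow> real) set" where
  "real_functions m = (mspace m \<rightarrow>\<^sub>E UNIV)"

text \<open>
  The basic neighbourhoods of \<open>f\<close> ask for a uniform \<open>\<epsilon>\<close>-approximation on a single bounded set;
  this suffices because finite unions of bounded sets are bounded.
\<close>

definition open_unif_bounded :: "'a metric \<Rightarrow> ('a \<Rightarrow> real) set \<Rightarrow> bool" where
  "open_unif_bounded m U \<longleftrightarrow>
     U \<subseteq> real_functions m \<and>
     (\<forall>f\<in>U. \<exists>B \<epsilon>. Metric_space.mbounded (mspace m) (mdist m) B \<and> \<epsilon> > 0 \<and>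
        {g \<in> real_functions m. \<forall>w\<in>B. \<bar>g w - f w\<bar> < \<epsilon>} \<subseteq> U)"

definition unif_bounded_topology :: "'a metric \<Rightarrow> ('a \<Rightarrow> real) topology" where
  "unif_bounded_topology m = topology (open_unif_bounded m)"

lemma istopology_open_unif_bounded: "istopology (open_unif_bounded m)"
  unfolding istopology_def
proof (intro conjI allI impI)
  interpret M: Metric_space "mspace m" "mdist m"
    by (rule Metric_space_mspace_mdist)
  fix S T assume S: "open_unif_bounded m S" and T: "open_unif_bounded m T"
  show "open_unif_bounded m (S \<inter> T)"
    unfolding open_unif_bounded_def
  proof (intro conjI ballI)
    show "S \<inter> T \<subseteq> real_functions m"
      using S by (auto simp: open_unif_bounded_def)
    fix f assume f: "f \<in> S \<inter> T"
    obtain B \<epsilon> where 1: "M.mbounded B" "\<epsilon> > 0"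
      "{g \<in> real_functions m. \<forall>w\<in>B. \<bar>g w - f w\<bar> < \<epsilon>} \<subseteq> S"
      using S f unfolding open_unif_bounded_def by blast
    obtain C \<delta> where 2: "M.mbounded C" "\<delta> > 0"
      "{g \<in> real_functions m. \<forall>w\<in>C. \<bar>g w - f w\<bar> < \<delta>} \<subseteq> T"
      using T f unfolding open_unif_bounded_def by blast
    have "M.mbounded (B \<union> C)" "min \<epsilon> \<delta> > 0"
      using 1 2 by (simp_all add: M.mbounded_Un)
    moreover have "{g \<in> real_functions m. \<forall>w\<in>B \<union> C. \<bar>g w - f w\<bar> < min \<epsilon> \<delta>} \<subseteq> S \<inter> T"
      using 1(3) 2(3) by fastforce
    ultimately show "\<exists>B \<epsilon>. M.mbounded B \<and> \<epsilon> > 0 \<and>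
        {g \<in> real_functions m. \<forall>w\<in>B. \<bar>g w - f w\<bar> < \<epsilon>} \<subseteq> S \<inter> T"
      by blast
  qed
next
  fix K assume K: "\<forall>S\<in>K. open_unif_bounded m S"
  show "open_unif_bounded m (\<Union>K)"
    unfolding open_unif_bounded_def
  proof (intro conjI ballI)
    show "\<Union>K \<subseteq> real_functions m"
      using K by (auto simp: open_unif_bounded_def)
    fix f assume "f \<in> \<Union>K"
    then obtain S where S: "S \<in> K" "f \<in> S" by blast
    then obtain B \<epsilon> where "Metric_space.mbounded (mspace m) (mdist m) B" "\<epsilon> > 0"
      "{g \<in> real_functions m. \<forall>w\<in>B. \<bar>g w - f w\<bar> < \<epsilon>} \<subseteq> S"
      using K unfolding open_unif_bounded_def by blast
    moreover from S have "S \<subseteq> \<Union>K" by blast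
    ultimately show "\<exists>B \<epsilon>. Metric_space.mbounded (mspace m) (mdist m) B \<and> \<epsilon> > 0 \<and>
        {g \<in> real_functions m. \<forall>w\<in>B. \<bar>g w - f w\<bar> < \<epsilon>} \<subseteq> \<Union>K"
      by (meson subset_trans)
  qed
qed

lemma openin_unif_bounded_topology:
  "openin (unif_bounded_topology m) U \<longleftrightarrow> open_unif_bounded m U"
  unfolding unif_bounded_topology_def
  by (simp add: istopology_open_unif_bounded)

lemma topspace_unif_bounded_topology: "topspace (unif_bounded_topology m) = real_functions m"
proof
  show "topspace (unif_bounded_topology m) \<subseteq> real_functions m"
    by (auto simp: topspace_def openin_unif_bounded_topology open_unif_bounded_def)
  have "open_unif_bounded m (real_functions m)"
    unfolding open_unif_bounded_def
  proof (intro conjI ballI)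
    show "\<exists>B \<epsilon>. Metric_space.mbounded (mspace m) (mdist m) B \<and> \<epsilon> > 0 \<and>
        {g \<in> real_functions m. \<forall>w\<in>B. \<bar>g w - f w\<bar> < \<epsilon>} \<subseteq> real_functions m" for f
      by (intro exI[of _ "{}"] exI[of _ 1])
        (simp add: Metric_space.mbounded_empty[OF Metric_space_mspace_mdist])
  qed simp
  then show "real_functions m \<subseteq> topspace (unif_bounded_topology m)"
    by (simp add: openin_subset openin_unif_bounded_topology)
qed

definition horo_embedding :: "'a metric \<Rightarrow> 'a \<Rightarrow> 'a \<Rightarrow> ('a \<Rightarrow> real)" where
  "horo_embedding m x0 z = (\<lambda>w\<in>mspace m. mdist m w z - mdist m x0 z)"

definition horofunction_bordification :: "'a metric \<Rightarrow> 'a \<Rightarrow> ('a \<Rightarrow> real) set" where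
  "horofunction_bordification m x0 =
     unif_bounded_topology m closure_of (horo_embedding m x0 ` mspace m)"

end

theory Submission
  imports Defs
begin

text \<open>
  Let \<open>Y\<close> be the ray \<open>0, 1, 2, \<dots>\<close> with its usual metric and base point \<open>0\<close>. Moving along the
  ray to infinity, the functions \<open>h\<^sub>n\<close> converge on \<open>Y\<close> to \<open>h w = - w\<close>. Enlarge the ray by
  satellites \<open>p\<^sub>1, p\<^sub>2, \<dots>\<close>, all at distance \<open>1\<close> from the base point, such that \<open>n\<close> has distance
  \<open>n + 1\<close> from \<open>p\<^sub>k\<close> as long as \<open>n \<le> k\<close>, and distance \<open>n\<close> as soon as \<open>n > k\<close>. On the satellites
  the functions \<open>h\<^sub>n\<close> then converge pointwise to \<open>0\<close>, but every \<open>h\<^sub>n\<close> still has the value \<open>1\<close> at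
  \<open>p\<^sub>n\<close>. The satellites form a bounded set, so the convergence is not uniform on bounded sets.

  An extension \<open>H\<close> of \<open>h\<close> would be approximated, uniformly on bounded sets, by functions \<open>h\<^sub>z\<close>;
  closeness to \<open>- N\<close> at the single point \<open>N\<close> already forces \<open>z\<close> to be a point of the ray beyond \<open>N\<close>
  (\<open>approximant_far_out\<close>). So two functions \<open>h\<^sub>n\<close> and \<open>h\<^sub>m\<close> with \<open>n < m\<close> would both be within
  \<open>1/2\<close> of \<open>H\<close> on all satellites, although they differ by \<open>1\<close> at \<open>p\<^sub>n\<close>.

  The satellite \<open>p\<^sub>k\<close> is encoded as the negative integer \<open>- k\<close>.
\<close>

text \<open>
  A basic neighbourhood of \<open>f\<close> need not be open, because the supremum of \<open>\<bar>g w - f w\<bar>\<close> over \<open>B\<close>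
  can equal \<open>\<epsilon>\<close>. Functions that stay within some \<open>\<delta> < \<epsilon>\<close> of \<open>f\<close> on \<open>B\<close> form an open set inside it.
\<close>

lemma open_unif_bounded_strict_ball:
  assumes B: "Metric_space.mbounded (mspace m) (mdist m) B"
  shows "open_unif_bounded m {g \<in> real_functions m. \<exists>\<delta><\<epsilon>. \<forall>w\<in>B. \<bar>g w - f w\<bar> \<le> \<delta>}"
    (is "open_unif_bounded m ?U")
  unfolding open_unif_bounded_def
proof (intro conjI ballI)
  show "?U \<subseteq> real_functions m" by blast
  fix g assume "g \<in> ?U"
  then obtain \<delta> where \<delta>: "\<delta> < \<epsilon>" "\<forall>w\<in>B. \<bar>g w - f w\<bar> \<le> \<delta>" by blast
  have "{k \<in> real_functions m. \<forall>w\<in>B. \<bar>k w - g w\<bar> < (\<epsilon> - \<delta>) / 2} \<subseteq> ?U"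
  proof clarify
    fix k assume k: "k \<in> real_functions m" "\<forall>w\<in>B. \<bar>k w - g w\<bar> < (\<epsilon> - \<delta>) / 2"
    have "\<bar>k w - f w\<bar> \<le> (\<epsilon> + \<delta>) / 2" if "w \<in> B" for w
    proof -
      have "\<bar>k w - f w\<bar> \<le> \<bar>k w - g w\<bar> + \<bar>g w - f w\<bar>" by linarith
      also have "\<dots> \<le> (\<epsilon> - \<delta>) / 2 + \<delta>"
        using k(2) \<delta>(2) that by (intro add_mono) (auto intro: less_imp_le)
      also have "\<dots> = (\<epsilon> + \<delta>) / 2" by (simp add: field_simps)
      finally show ?thesis .
    qed
    moreover have "(\<epsilon> + \<delta>) / 2 < \<epsilon>" using \<delta> by simp
    ultimately show "\<exists>\<delta><\<epsilon>. \<forall>w\<in>B. \<bar>k w - f w\<bar> \<le> \<delta>" by blast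
  qed
  moreover have "(\<epsilon> - \<delta>) / 2 > 0" using \<delta> by simp
  ultimately show "\<exists>B \<epsilon>. Metric_space.mbounded (mspace m) (mdist m) B \<and> \<epsilon> > 0 \<and>
      {k \<in> real_functions m. \<forall>w\<in>B. \<bar>k w - g w\<bar> < \<epsilon>} \<subseteq> ?U"
    using B by blast
qed

lemma in_horofunction_bordification_iff:
  "f \<in> horofunction_bordification m x0 \<longleftrightarrow>
     f \<in> real_functions m \<and>
     (\<forall>B \<epsilon>. Metric_space.mbounded (mspace m) (mdist m) B \<and> \<epsilon> > 0 \<longrightarrow>
        (\<exists>z\<in>mspace m. \<forall>w\<in>B. \<bar>horo_embedding m x0 z w - f w\<bar> < \<epsilon>))"
    (is "?L \<longleftrightarrow> ?R")
proof
  assume L: ?L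
  then have f: "f \<in> real_functions m"
    and meet: "\<And>T. f \<in> T \<Longrightarrow> open_unif_bounded m T \<Longrightarrow> \<exists>g\<in>horo_embedding m x0 ` mspace m. g \<in> T"
    by (auto simp: horofunction_bordification_def in_closure_of
        topspace_unif_bounded_topology openin_unif_bounded_topology)
  have "\<exists>z\<in>mspace m. \<forall>w\<in>B. \<bar>horo_embedding m x0 z w - f w\<bar> < \<epsilon>"
    if B: "Metric_space.mbounded (mspace m) (mdist m) B" and \<epsilon>: "\<epsilon> > 0" for B \<epsilon>
  proof -
    have "f \<in> {g \<in> real_functions m. \<exists>\<delta><\<epsilon>. \<forall>w\<in>B. \<bar>g w - f w\<bar> \<le> \<delta>}"
      using f \<epsilon> by auto
    from meet[OF this open_unif_bounded_strict_ball[OF B]]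
    obtain z \<delta> where "z \<in> mspace m" "\<delta> < \<epsilon>" "\<forall>w\<in>B. \<bar>horo_embedding m x0 z w - f w\<bar> \<le> \<delta>"
      by blast
    then show ?thesis
      by (intro bexI[of _ z] ballI) (auto intro: order.strict_trans1)
  qed
  with f show ?R by blast
next
  assume R: ?R
  have "\<exists>g\<in>horo_embedding m x0 ` mspace m. g \<in> T" if T: "f \<in> T" "open_unif_bounded m T" for T
  proof -
    obtain B \<epsilon> where B: "Metric_space.mbounded (mspace m) (mdist m) B" "\<epsilon> > 0"
      "{g \<in> real_functions m. \<forall>w\<in>B. \<bar>g w - f w\<bar> < \<epsilon>} \<subseteq> T"
      using T unfolding open_unif_bounded_def by blast
    obtain z where "z \<in> mspace m" "\<forall>w\<in>B. \<bar>horo_embedding m x0 z w - f w\<bar> < \<epsilon>"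
      using R B by blast
    moreover have "horo_embedding m x0 z \<in> real_functions m"
      by (simp add: horo_embedding_def real_functions_def)
    ultimately show ?thesis using B(3) by blast
  qed
  with R show ?L
    by (auto simp: horofunction_bordification_def in_closure_of
        topspace_unif_bounded_topology openin_unif_bounded_topology)
qed

text \<open>
  In the mixed case the larger argument is the point \<open>n\<close> of the ray and the smaller one is the
  satellite \<open>- k\<close>, so that \<open>i + j \<le> 0\<close> says \<open>n \<le> k\<close>.
\<close>

definition satellite_dist :: "int \<Rightarrow> int \<Rightarrow> int" where
  "satellite_dist i j =
     (if i = j then 0
      else if 0 \<le> i \<and> 0 \<le> j then \<bar>i - j\<bar>
      else if i < 0 \<and> j < 0 then 2
      else max i j + (if i + j \<le> 0 then 1 else 0))"

lemma satellite_dist_nonneg: "0 \<le> satellite_dist i j"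
  by (auto simp: satellite_dist_def max_def)

lemma satellite_dist_commute: "satellite_dist i j = satellite_dist j i"
  by (auto simp: satellite_dist_def max_def)

lemma satellite_dist_eq_0_iff: "satellite_dist i j = 0 \<longleftrightarrow> i = j"
  by (auto simp: satellite_dist_def max_def)

text \<open>
  Integrality matters here: the distance to \<open>- k\<close> stays constant from \<open>k\<close> to \<open>k + 1\<close>
  and would jump down if the ray were continuous.
\<close>

lemma satellite_dist_triangle:
  "satellite_dist i l \<le> satellite_dist i j + satellite_dist j l"
  by (auto simp: satellite_dist_def max_def abs_if)

definition satellite_space :: "real metric" where
  "satellite_space = metric (\<int>, \<lambda>x y. real_of_int (satellite_dist \<lfloor>x\<rfloor> \<lfloor>y\<rfloor>))"

lemma Metric_space_satellite:
  "Metric_space (\<int> :: real set) (\<lambda>x y. real_of_int (satellite_dist \<lfloor>x\<rfloor> \<lfloor>y\<rfloor>))"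
proof
  show "0 \<le> real_of_int (satellite_dist \<lfloor>x\<rfloor> \<lfloor>y\<rfloor>)" for x y :: real
    by (simp add: satellite_dist_nonneg)
  show "real_of_int (satellite_dist \<lfloor>x\<rfloor> \<lfloor>y\<rfloor>) = real_of_int (satellite_dist \<lfloor>y\<rfloor> \<lfloor>x\<rfloor>)" for x y :: real
    by (simp add: satellite_dist_commute)
  show "real_of_int (satellite_dist \<lfloor>x\<rfloor> \<lfloor>y\<rfloor>) = 0 \<longleftrightarrow> x = y"
    if "x \<in> \<int>" "y \<in> \<int>" for x y :: real
    using that by (auto simp: satellite_dist_eq_0_iff elim!: Ints_cases)
  show "real_of_int (satellite_dist \<lfloor>x\<rfloor> \<lfloor>z\<rfloor>)
      \<le> real_of_int (satellite_dist \<lfloor>x\<rfloor> \<lfloor>y\<rfloor>) + real_of_int (satellite_dist \<lfloor>y\<rfloor> \<lfloor>z\<rfloor>)" for x y z :: real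
    using satellite_dist_triangle[of "\<lfloor>x\<rfloor>" "\<lfloor>z\<rfloor>" "\<lfloor>y\<rfloor>"] by linarith
qed

lemma mspace_satellite [simp]: "mspace satellite_space = \<int>"
  by (simp add: satellite_space_def Metric_space.mspace_metric[OF Metric_space_satellite])

lemma mdist_satellite [simp]:
  "mdist satellite_space (of_int i) (of_int j) = of_int (satellite_dist i j)"
  by (simp add: satellite_space_def Metric_space.mdist_metric[OF Metric_space_satellite])

lemma horo_embedding_satellite:
  "horo_embedding satellite_space 0 (of_int z) (of_int w)
     = of_int (satellite_dist w z - satellite_dist 0 z)"
  using mdist_satellite[of 0 z] by (simp add: horo_embedding_def del: mdist_satellite) simp

abbreviation ray :: "real set" where
  "ray \<equiv> of_int ` {0..}"

lemma mbounded_ray_below: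
  assumes "Metric_space.mbounded (mspace (submetric satellite_space ray))
             (mdist (submetric satellite_space ray)) B"
  shows "\<exists>N\<ge>0. B \<subseteq> of_int ` {0..N}"
proof -
  let ?S = "submetric satellite_space ray"
  interpret S: Metric_space "mspace ?S" "mdist ?S"
    by (rule Metric_space_mspace_mdist)
  have sp: "mspace ?S = ray" by auto
  obtain a r where ar: "B \<subseteq> S.mcball a r"
    using assms unfolding S.mbounded_def by blast
  show ?thesis
  proof (cases "B = {}")
    case False
    then have "a \<in> ray" using ar sp S.in_mcball by blast
    then obtain i where i: "a = of_int i" "i \<ge> 0" by auto
    have "x \<in> of_int ` {0..max 0 (i + \<lceil>r\<rceil>)}" if "x \<in> B" for x
    proof -
      have "x \<in> S.mcball a r" using that ar by blast
      then have "x \<in> mspace ?S" and "mdist ?S a x \<le> r"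
        unfolding S.in_mcball by blast+
      then have "x \<in> ray" and d: "mdist satellite_space a x \<le> r"
        unfolding sp by simp_all
      then obtain j where j: "x = of_int j" "j \<ge> 0" by auto
      have "real_of_int (satellite_dist i j) \<le> r" using d i j by simp
      then have "satellite_dist i j \<le> \<lceil>r\<rceil>" by linarith
      then have "j \<le> i + \<lceil>r\<rceil>" using i j by (auto simp: satellite_dist_def split: if_splits)
      with j show ?thesis by auto
    qed
    then show ?thesis by (intro exI[of _ "max 0 (i + \<lceil>r\<rceil>)"]) auto
  qed auto
qed

text \<open>On \<open>{0..N}\<close> the function \<open>h\<^sub>N\<close> agrees exactly with the limit.\<close>

lemma uminus_in_ray_bordification:
  "(\<lambda>w\<in>ray. - w) \<in> horofunction_bordification (submetric satellite_space ray) 0"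
  unfolding in_horofunction_bordification_iff
proof (intro conjI allI impI)
  have sp: "mspace (submetric satellite_space ray) = ray" by auto
  show "(\<lambda>w\<in>ray. - w) \<in> real_functions (submetric satellite_space ray)"
    unfolding real_functions_def sp by simp
  fix B and \<epsilon> :: real
  assume B\<epsilon>: "Metric_space.mbounded (mspace (submetric satellite_space ray))
               (mdist (submetric satellite_space ray)) B \<and> \<epsilon> > 0"
  then obtain N :: int where N: "N \<ge> 0" "B \<subseteq> of_int ` {0..N}"
    using mbounded_ray_below by blast
  have "horo_embedding (submetric satellite_space ray) 0 (of_int N) w = (\<lambda>w\<in>ray. - w) w"
    if "w \<in> B" for w
  proof -
    have "w \<in> of_int ` {0..N}" using N that by blast
    then obtain j where j: "w = of_int j" "0 \<le> j" "j \<le> N" by auto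
    show ?thesis
      using j N mdist_satellite[of 0 N] unfolding horo_embedding_def sp
      by (auto simp: satellite_dist_def)
  qed
  then show "\<exists>z\<in>mspace (submetric satellite_space ray).
      \<forall>w\<in>B. \<bar>horo_embedding (submetric satellite_space ray) 0 z w - (\<lambda>w\<in>ray. - w) w\<bar> < \<epsilon>"
    unfolding sp using N B\<epsilon> by (intro bexI[of _ "of_int N"]) auto
qed

lemma mbounded_satellites:
  assumes "N \<ge> 1"
  shows "Metric_space.mbounded (mspace satellite_space) (mdist satellite_space)
           (of_int ` insert N {..<0})"
proof -
  interpret M: Metric_space "mspace satellite_space" "mdist satellite_space"
    by (rule Metric_space_mspace_mdist)
  have "of_int ` insert N {..<0} \<subseteq> M.mcball (of_int 0) (of_int N)"
    using assms unfolding M.mcball_def image_subset_iff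
    by (auto simp del: of_int_0 simp: satellite_dist_def)
  then show ?thesis unfolding M.mbounded_def by blast
qed

text \<open>
  At \<open>N\<close> the function of a satellite has a value of at least \<open>N - 1\<close>, and the function of a
  point \<open>z < N\<close> of the ray has the value \<open>N - 2 z\<close>; both are at least \<open>1\<close> away from \<open>- N\<close>.
\<close>

lemma approximant_far_out:
  assumes "N \<ge> 1"
    and "\<bar>horo_embedding satellite_space 0 (of_int z) (of_int N) + of_int N\<bar> < 1"
  shows "z \<ge> N"
proof -
  have "\<bar>satellite_dist N z - satellite_dist 0 z + N\<bar> < 1"
    using assms(2) unfolding horo_embedding_satellite by linarith
  with assms(1) show ?thesis
    unfolding satellite_dist_def by (smt (verit))
qed

theorem mainTheorem2:
  "\<exists>(X :: real metric) x0 Y h.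
     Y \<subseteq> mspace X \<and> x0 \<in> Y \<and>
     h \<in> horofunction_bordification (submetric X Y) x0 \<and>
     \<not> (\<exists>H \<in> horofunction_bordification X x0. restrict H Y = h)"
proof (intro exI conjI)
  show "ray \<subseteq> mspace satellite_space" by auto
  show "0 \<in> ray" by (auto intro: image_eqI[of _ _ 0])
  show "(\<lambda>w\<in>ray. - w) \<in> horofunction_bordification (submetric satellite_space ray) 0"
    by (rule uminus_in_ray_bordification)
  show "\<not> (\<exists>H \<in> horofunction_bordification satellite_space 0. restrict H ray = (\<lambda>w\<in>ray. - w))"
  proof
    assume "\<exists>H \<in> horofunction_bordification satellite_space 0. restrict H ray = (\<lambda>w\<in>ray. - w)"
    then obtain H where H: "H \<in> horofunction_bordification satellite_space 0"
      and ext: "restrict H ray = (\<lambda>w\<in>ray. - w)" by blast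
    have H_ray: "H (of_int N) = - of_int N" if "N \<ge> 0" for N
      using fun_cong[OF ext, of "of_int N"] that by (auto simp: restrict_def split: if_splits)
    have approx: "\<exists>n\<ge>N. \<forall>k<0. \<bar>horo_embedding satellite_space 0 (of_int n) (of_int k) - H (of_int k)\<bar> < 1/2"
      if N: "N \<ge> 1" for N :: int
    proof -
      have "\<exists>z\<in>\<int>. \<forall>w\<in>of_int ` insert N {..<0}. \<bar>horo_embedding satellite_space 0 z w - H w\<bar> < 1/2"
        using H[unfolded in_horofunction_bordification_iff, THEN conjunct2, THEN spec, THEN spec, THEN mp,
            OF conjI, OF mbounded_satellites[OF N] half_gt_zero[OF zero_less_one]]
        unfolding mspace_satellite .
      then obtain n where
        n: "\<forall>w\<in>of_int ` insert N {..<0}. \<bar>horo_embedding satellite_space 0 (of_int n) w - H w\<bar> < 1/2"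
        by (auto elim!: Ints_cases)
      then have "\<bar>horo_embedding satellite_space 0 (of_int n) (of_int N) - H (of_int N)\<bar> < 1/2"
        by blast
      then have "\<bar>horo_embedding satellite_space 0 (of_int n) (of_int N) + of_int N\<bar> < 1"
        using H_ray[of N] N by linarith
      then have "n \<ge> N"
        by (rule approximant_far_out[OF N])
      with n show ?thesis by blast
    qed
    obtain n where n: "n \<ge> 1"
      "\<forall>k<0. \<bar>horo_embedding satellite_space 0 (of_int n) (of_int k) - H (of_int k)\<bar> < 1/2"
      using approx[of 1] by auto
    obtain m where m: "m \<ge> n + 1"
      "\<forall>k<0. \<bar>horo_embedding satellite_space 0 (of_int m) (of_int k) - H (of_int k)\<bar> < 1/2"
      using approx[of "n + 1"] n(1) by auto
    have "horo_embedding satellite_space 0 (of_int n) (of_int (- n)) = 1"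
      unfolding horo_embedding_satellite using n(1) by (simp add: satellite_dist_def)
    moreover have "horo_embedding satellite_space 0 (of_int m) (of_int (- n)) = 0"
      unfolding horo_embedding_satellite using n(1) m(1) by (simp add: satellite_dist_def)
    ultimately show False
      using n(1) n(2)[rule_format, of "- n"] m(2)[rule_format, of "- n"] by linarith
  qed
qed

end
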